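(* Let $b\ge 2$ and $k\ge 1$ be integers, and let $\alpha(b,k):=\lfloor\vartheta(b)b^k\rfloor-Z_b(b^k)$. Then $\alpha(b,k)\ge 0$ and the number $\eta(b,k)$ of digits of the base-$b$ expansion of $\alpha(b,k)$ satisfies $$\eta(b,k)\le\lfloor\log_b k+2\rfloor.$$
   Context: $Z_b(m)$ is the number of trailing zeroes in the base-$b$ expansion of $m!$, i.e. the largest $e\ge0$ with $b^e\mid m!$. $\vartheta(b):=\lim_{m\to\infty}Z_b(m)/m$, which equals $\min_i \frac{1}{r_i(p_i-1)}$ when $b=p_1^{r_1}\cdots p_s^{r_s}$. For an integer $\alpha\ge1$, its number of base-$b$ digits is $\eta=\lfloor\log_b\alpha+1\rfloor$; for $\alpha=0$ we set $\eta=0$. *)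

theory Defs
  imports Complex_Main "HOL-Computational_Algebra.Primes"
begin

text \<open>\<open>multiplicity\<close> does not require a prime base: for \<open>b \<ge> 2\<close> this is the largest \<open>e\<close> with
  \<open>b ^ e dvd fact m\<close>.\<close>

definition trailing_zeros :: "nat \<Rightarrow> nat \<Rightarrow> nat" where
  "trailing_zeros b m = multiplicity b (fact m)"

definition vartheta :: "nat \<Rightarrow> real" where
  "vartheta b = lim (\<lambda>m. real (trailing_zeros b m) / real m)"

definition alpha :: "nat \<Rightarrow> nat \<Rightarrow> int" where
  "alpha b k = \<lfloor>vartheta b * real b ^ k\<rfloor> - int (trailing_zeros b (b ^ k))"

text \<open>Meaningful for \<open>a \<ge> 0\<close> only; the number 0 has no digits by convention.\<close>

definition num_digits :: "nat \<Rightarrow> int \<Rightarrow> int" where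
  "num_digits b a = (if a = 0 then 0 else \<lfloor>log (real b) (real_of_int a) + 1\<rfloor>)"

definition eta :: "nat \<Rightarrow> nat \<Rightarrow> int" where
  "eta b k = num_digits b (alpha b k)"

end

theory Submission
  imports Defs "HOL-Real_Asymp.Real_Asymp"
begin

text \<open>
  Write \<open>v\<close> for the \<open>p\<close>-adic valuation of \<open>n!\<close>. The recursion \<open>v(n!) = n div p + v((n div p)!)\<close>
  yields \<open>(p - 1) v \<le> n \<le> (p - 1) (v + L)\<close> whenever \<open>n < p ^ L\<close>. As \<open>Z\<^sub>b(n)\<close> is the minimum of the
  quotients \<open>v div r\<close> over the prime powers \<open>p ^ r\<close> exactly dividing \<open>b\<close>, this identifies
  \<open>\<vartheta>(b)\<close> as the minimum of \<open>1 / (r (p - 1))\<close> and gives \<open>Z\<^sub>b(n) \<le> \<vartheta>(b) n\<close>. For \<open>n = b ^ k\<close>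
  one may take \<open>L = b k\<close>, because \<open>b < 2 ^ b\<close>; hence \<open>0 \<le> \<alpha>(b, k) \<le> b k\<close>, which bounds the
  number of digits.
\<close>

lemma multiplicity_fact_prime_add:
  fixes p :: nat
  assumes "prime p" and "r < p"
  shows "multiplicity p (fact (p * q + r) :: nat) = multiplicity p (fact (p * q) :: nat)"
  using assms(2)
proof (induction r)
  case (Suc r)
  \<comment> \<open>Otherwise \<open>p\<close> would divide \<open>Suc r\<close>, which lies
    strictly between 0 and \<open>p\<close>.\<close>
  have "\<not> p dvd Suc (p * q + r)"
    using Suc.prems dvd_add_right_iff[of p "p * q" "Suc r"] by (auto dest: dvd_imp_le)
  hence "multiplicity p (Suc (p * q + r)) = 0"
    by (rule not_dvd_imp_multiplicity_0)
  with Suc assms(1) show ?case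
    by (simp add: prime_elem_multiplicity_mult_distrib del: mult_Suc)
qed simp

text \<open>Among the factors \<open>p * q + 1\<close> to \<open>p * q + p\<close> only the last is
  a multiple of \<open>p\<close>. It contributes one plus the valuation of \<open>Suc q\<close>, the
  factor leading from \<open>fact q\<close> to \<open>fact (Suc q)\<close>.\<close>

lemma multiplicity_fact_prime_mult:
  fixes p :: nat
  assumes "prime p"
  shows "multiplicity p (fact (p * q) :: nat) = q + multiplicity p (fact q :: nat)"
proof (induction q)
  case (Suc q)
  have p: "p > 0" "Suc (p - 1) = p" using prime_gt_0_nat[OF assms] by simp_all
  have "p * Suc q = Suc (p * q + (p - 1))" using p by simp
  hence "(fact (p * Suc q) :: nat) = (p * Suc q) * fact (p * q + (p - 1))"
    by (metis fact_Suc of_nat_id)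
  hence "multiplicity p (fact (p * Suc q) :: nat) =
      multiplicity p (p * Suc q) + multiplicity p (fact (p * q + (p - 1)) :: nat)"
    using assms p by (simp add: prime_elem_multiplicity_mult_distrib del: mult_Suc mult_Suc_right)
  also have "multiplicity p (p * Suc q) = Suc (multiplicity p (Suc q))"
    using assms by (simp add: prime_elem_multiplicity_mult_distrib prime_gt_0_nat del: mult_Suc mult_Suc_right)
  also have "multiplicity p (fact (p * q + (p - 1)) :: nat) = multiplicity p (fact (p * q) :: nat)"
    by (rule multiplicity_fact_prime_add) (use assms p in auto)
  also note Suc.IH
  also have "Suc (multiplicity p (Suc q)) + (q + multiplicity p (fact q :: nat)) =
      Suc q + multiplicity p (fact (Suc q) :: nat)"
    using assms by (simp add: prime_elem_multiplicity_mult_distrib del: mult_Suc)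
  finally show ?case .
qed simp

lemma multiplicity_fact_prime_div:
  fixes p :: nat
  assumes "prime p"
  shows "multiplicity p (fact n :: nat) = n div p + multiplicity p (fact (n div p) :: nat)"
  using multiplicity_fact_prime_add[OF assms, of "n mod p" "n div p"]
    multiplicity_fact_prime_mult[OF assms, of "n div p"] prime_gt_0_nat[OF assms]
  by simp

text \<open>By Legendre's formula the left side is \<open>n\<close> minus its base-\<open>p\<close>
  digit sum. The recursion avoids digit sums: with \<open>q = n div p\<close>, it suffices that
  \<open>(p - 1) * q + q = p * q \<le> n\<close>.\<close>

lemma multiplicity_fact_prime_upper:
  fixes p :: nat
  assumes "prime p"
  shows "(p - 1) * multiplicity p (fact n :: nat) \<le> n"
proof (induction n rule: less_induct)
  case (less n)
  show ?case
  proof (cases "n = 0")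
    case False
    define q where "q = n div p"
    have "q < n" using False prime_gt_1_nat[OF assms] by (simp add: q_def)
    have "(p - 1) * multiplicity p (fact n :: nat) =
        (p - 1) * q + (p - 1) * multiplicity p (fact q :: nat)"
      by (subst multiplicity_fact_prime_div[OF assms]) (simp add: q_def algebra_simps)
    also have "\<dots> \<le> (p - 1) * q + q" using less[OF \<open>q < n\<close>] by simp
    also have "\<dots> = p * q" using prime_gt_0_nat[OF assms] by (simp add: algebra_simps)
    also have "\<dots> \<le> n" by (simp add: q_def)
    finally show ?thesis .
  qed simp
qed

text \<open>In Legendre's formula the digit sum is at most \<open>(p - 1) * L\<close>, as
  \<open>n\<close> has at most \<open>L\<close> digits in base \<open>p\<close>. In the recursion,
  each step drops a remainder of at most \<open>p - 1\<close>, paid for by one unit of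
  \<open>L\<close>.\<close>

lemma multiplicity_fact_prime_lower:
  fixes p :: nat
  assumes "prime p" and "n < p ^ L"
  shows "n \<le> (p - 1) * (multiplicity p (fact n :: nat) + L)"
  using assms(2)
proof (induction L arbitrary: n)
  case (Suc L)
  define q where "q = n div p"
  have p: "p > 0" using prime_gt_0_nat[OF assms(1)] .
  have "q < p ^ L"
    using Suc.prems p by (simp add: q_def div_less_iff_less_mult mult.commute)
  note IH = Suc.IH[OF this]
  have "n mod p \<le> p - 1" using mod_less_divisor[OF p, of n] by linarith
  moreover have "n = (p - 1) * q + q + n mod p"
    using p by (simp add: q_def algebra_simps)
  ultimately have "n \<le> (p - 1) * q + (p - 1) * (multiplicity p (fact q :: nat) + L) + (p - 1)"
    using IH by linarith
  also have "\<dots> = (p - 1) * (multiplicity p (fact n :: nat) + Suc L)"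
    by (subst multiplicity_fact_prime_div[OF assms(1), of n]) (simp add: q_def algebra_simps)
  finally show ?case .
qed simp

lemma power_dvd_iff_multiplicity:
  fixes b x :: nat
  assumes "b > 0" "x > 0"
  shows "b ^ e dvd x \<longleftrightarrow> (\<forall>p\<in>prime_factors b. e * multiplicity p b \<le> multiplicity p x)"
proof
  assume "b ^ e dvd x"
  thus "\<forall>p\<in>prime_factors b. e * multiplicity p b \<le> multiplicity p x"
    using assms
    by (metis dvd_imp_multiplicity_le in_prime_factors_imp_prime not_gr_zero
        prime_elem_multiplicity_power_distrib prime_imp_prime_elem)
next
  assume *: "\<forall>p\<in>prime_factors b. e * multiplicity p b \<le> multiplicity p x"
  show "b ^ e dvd x"
  proof (rule multiplicity_le_imp_dvd)
    fix p :: nat assume "prime p"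
    thus "multiplicity p (b ^ e) \<le> multiplicity p x"
      using * assms
      by (cases "p dvd b")
         (auto simp: prime_elem_multiplicity_power_distrib in_prime_factors_iff
            not_dvd_imp_multiplicity_0)
  qed (use assms in auto)
qed

lemma multiplicity_le_div:
  fixes b x p :: nat
  assumes "b > 1" "x > 0" "p \<in> prime_factors b"
  shows "multiplicity b x \<le> multiplicity p x div multiplicity p b"
proof -
  have "multiplicity b x * multiplicity p b \<le> multiplicity p x"
    using power_dvd_iff_multiplicity[of b x "multiplicity b x"] assms multiplicity_dvd[of b x] by auto
  moreover have "multiplicity p b > 0"
    using assms by (simp add: prime_factors_multiplicity)
  ultimately show ?thesis by (simp add: less_eq_div_iff_mult_less_eq)
qed

text \<open>A prime factor that keeps one further power of \<open>b\<close> from dividing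
  \<open>x\<close> attains the minimum of the quotients.\<close>

lemma ex_prime_factor_multiplicity_eq_div:
  fixes b x :: nat
  assumes "b > 1" "x > 0"
  shows "\<exists>p\<in>prime_factors b. multiplicity b x = multiplicity p x div multiplicity p b"
proof -
  have "\<not> b ^ Suc (multiplicity b x) dvd x"
    using assms by (subst power_dvd_iff_le_multiplicity) auto
  then obtain p where p: "p \<in> prime_factors b"
    and *: "multiplicity p x < Suc (multiplicity b x) * multiplicity p b"
    using power_dvd_iff_multiplicity[of b x "Suc (multiplicity b x)"] assms by (auto simp: not_le)
  have "multiplicity p x div multiplicity p b < Suc (multiplicity b x)"
    using * by (rule less_mult_imp_div_less)
  with multiplicity_le_div[OF assms p] p show ?thesis by (intro bexI[of _ p]) auto
qed

text \<open>The closed form expected for \<open>vartheta\<close>. As \<open>lim\<close> is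
  informative only once convergence is known, the estimates are first proved for this value.\<close>

definition zero_density :: "nat \<Rightarrow> real" where
  "zero_density b =
     Min ((\<lambda>p. 1 / (real (multiplicity p b) * (real p - 1))) ` prime_factors b)"

lemma zero_density_le:
  assumes "p \<in> prime_factors b"
  shows "zero_density b \<le> 1 / (real (multiplicity p b) * (real p - 1))"
  unfolding zero_density_def using assms by (intro Min_le) auto

text \<open>Every prime factor bounds the number of zeros from above, so the one attaining the
  minimum in \<open>zero_density\<close> may be chosen.\<close>

lemma trailing_zeros_le:
  assumes "b \<ge> 2"
  shows "real (trailing_zeros b m) \<le> zero_density b * real m"
proof -
  have "prime_factors b \<noteq> {}" using assms by (auto simp: prime_factorization_empty_iff)
  hence "zero_density b \<in> (\<lambda>p. 1 / (real (multiplicity p b) * (real p - 1))) ` prime_factors b"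
    unfolding zero_density_def by (intro Min_in) auto
  then obtain p where p: "p \<in> prime_factors b"
    and c: "zero_density b = 1 / (real (multiplicity p b) * (real p - 1))" by auto
  define r v where "r = multiplicity p b" and "v = multiplicity p (fact m :: nat)"
  have prime: "prime p" and r: "r > 0" using p by (auto simp: r_def prime_factors_multiplicity)
  have p1: "real p - 1 = real (p - 1)" "p - 1 > 0"
    using prime_gt_1_nat[OF prime] by (auto simp: of_nat_diff)
  have "trailing_zeros b m \<le> v div r"
    using multiplicity_le_div[of b "fact m" p] assms p
    by (simp add: trailing_zeros_def r_def v_def)
  hence "trailing_zeros b m * r \<le> v" using r by (simp add: less_eq_div_iff_mult_less_eq)
  hence "(p - 1) * (trailing_zeros b m * r) \<le> m"
    using multiplicity_fact_prime_upper[OF prime, of m] by (fold v_def) (meson le_trans mult_le_mono2)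
  hence "real (p - 1) * (real (trailing_zeros b m) * real r) \<le> real m"
    by (metis of_nat_le_iff of_nat_mult)
  thus ?thesis
    using r p1 unfolding c r_def[symmetric] p1(1) by (simp add: field_simps)
qed

text \<open>The roles are reversed: the prime is one that determines the number of zeros, and its
  term bounds \<open>zero_density\<close>. Which prime this is depends on \<open>m\<close>, so
  \<open>L\<close> has to serve all prime factors.\<close>

lemma trailing_zeros_ge:
  assumes "b \<ge> 2" and L: "\<And>p. p \<in> prime_factors b \<Longrightarrow> m < p ^ L"
  shows "\<lfloor>zero_density b * real m\<rfloor> \<le> int (trailing_zeros b m) + int L"
proof -
  obtain p where p: "p \<in> prime_factors b"
    and Z: "trailing_zeros b m = multiplicity p (fact m :: nat) div multiplicity p b"
    using ex_prime_factor_multiplicity_eq_div[of b "fact m"] assms(1)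
    by (auto simp: trailing_zeros_def)
  define r v where "r = multiplicity p b" and "v = multiplicity p (fact m :: nat)"
  have prime: "prime p" and r: "r > 0" using p by (auto simp: r_def prime_factors_multiplicity)
  have p1: "real p - 1 = real (p - 1)" "p - 1 > 0"
    using prime_gt_1_nat[OF prime] by (auto simp: of_nat_diff)
  have "zero_density b * real m \<le> 1 / (real r * (real p - 1)) * real m"
    using zero_density_le[OF p] by (intro mult_right_mono) (auto simp: r_def)
  also have "real m \<le> real (p - 1) * real (v + L)"
    using multiplicity_fact_prime_lower[OF prime L[OF p]]
    by (metis v_def of_nat_le_iff of_nat_mult)
  hence "1 / (real r * (real p - 1)) * real m \<le>
      1 / (real r * (real p - 1)) * (real (p - 1) * real (v + L))"
    by (intro mult_left_mono) (auto simp: p1)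
  also have "\<dots> = real v / real r + real L / real r"
    using p1 r by (simp add: field_simps)
  also have "real L / real r \<le> real L"
    using r by (simp add: divide_le_eq mult_le_cancel_left1)
  finally have "\<lfloor>zero_density b * real m\<rfloor> \<le> \<lfloor>real v / real r + of_int (int L)\<rfloor>"
    by (intro floor_mono) simp
  \<comment> \<open>Since \<open>L\<close> is an integer, the floor turns \<open>v / r\<close> into
    exactly \<open>v div r\<close>, and no rounding error is added.\<close>
  also have "\<dots> = int (v div r) + int L"
    by (simp only: floor_add_int[symmetric] floor_divide_of_nat_eq)
  finally show ?thesis by (simp add: Z r_def v_def)
qed

lemma vartheta_eq_zero_density:
  assumes "b \<ge> 2"
  shows "vartheta b = zero_density b"
proof -
  have lower: "zero_density b - (log 2 (real m) + 2) / real m \<le> real (trailing_zeros b m) / real m"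
    if m: "m > 0" for m
  proof -
    \<comment> \<open>The number of binary digits of \<open>m\<close>; it serves every prime factor,
      each being at least 2, and is negligible against \<open>m\<close>.\<close>
    define L where "L = nat \<lfloor>log 2 (real m)\<rfloor> + 1"
    have "log 2 (real m) \<ge> 0" using m by simp
    hence L: "log 2 (real m) < real L" "real L \<le> log 2 (real m) + 1"
      unfolding L_def by linarith+
    have "real m < 2 ^ L" using L(1) m by (simp add: log_less_iff powr_realpow)
    hence "m < 2 ^ L" by (metis of_nat_less_numeral_power_cancel_iff)
    have "\<lfloor>zero_density b * real m\<rfloor> \<le> int (trailing_zeros b m) + int L"
    proof (rule trailing_zeros_ge[OF assms])
      fix p assume "p \<in> prime_factors b"
      hence "2 ^ L \<le> p ^ L" by (intro power_mono) (auto intro: prime_ge_2_nat)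
      thus "m < p ^ L" using \<open>m < 2 ^ L\<close> by linarith
    qed
    \<comment> \<open>The floor costs less than 1 and \<open>L\<close> exceeds the logarithm by at
      most 1, whence the constant 2 in \<open>lower\<close>.\<close>
    hence "zero_density b * real m < real (trailing_zeros b m) + real L + 1" by linarith
    with L(2) have "zero_density b * real m - (log 2 (real m) + 2) \<le> real (trailing_zeros b m)"
      by linarith
    hence "(zero_density b * real m - (log 2 (real m) + 2)) / real m
        \<le> real (trailing_zeros b m) / real m"
      by (rule divide_right_mono) simp
    thus ?thesis using m by (simp add: diff_divide_distrib)
  qed
  have "(\<lambda>m. real (trailing_zeros b m) / real m) \<longlonglongrightarrow> zero_density b"
  proof (rule tendsto_sandwich)
    show "(\<lambda>m. zero_density b - (log 2 (real m) + 2) / real m) \<longlonglongrightarrow> zero_density b"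
      by real_asymp
    show "\<forall>\<^sub>F m in sequentially. zero_density b - (log 2 (real m) + 2) / real m
        \<le> real (trailing_zeros b m) / real m"
      using eventually_gt_at_top[of 0] by eventually_elim (rule lower)
    show "\<forall>\<^sub>F m in sequentially. real (trailing_zeros b m) / real m \<le> zero_density b"
      using eventually_gt_at_top[of 0]
      by eventually_elim (use trailing_zeros_le[OF assms] in \<open>simp add: divide_le_eq\<close>)
  qed simp
  thus ?thesis unfolding vartheta_def by (rule limI)
qed

lemma alpha_nonneg:
  assumes "b \<ge> 2"
  shows "alpha b k \<ge> 0"
  using trailing_zeros_le[OF assms, of "b ^ k"]
  by (simp add: alpha_def vartheta_eq_zero_density[OF assms] le_floor_iff)

lemma alpha_le:
  assumes "b \<ge> 2" "k \<ge> 1"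
  shows "alpha b k \<le> int (b * k)"
proof -
  have "\<lfloor>zero_density b * real (b ^ k)\<rfloor> \<le> int (trailing_zeros b (b ^ k)) + int (b * k)"
  proof (rule trailing_zeros_ge[OF assms(1)])
    fix p assume "p \<in> prime_factors b"
    hence "2 ^ b \<le> p ^ b" by (intro power_mono) (auto intro: prime_ge_2_nat)
    hence "b < p ^ b" using less_exp[of b] by linarith
    \<comment> \<open>The right side is the \<open>k\<close>-th power of \<open>p ^ b\<close>;
      \<open>k \<ge> 1\<close> keeps the inequality strict.\<close>
    thus "b ^ k < p ^ (b * k)"
      using assms(2) by (simp add: power_mult power_strict_mono)
  qed
  thus ?thesis by (simp add: alpha_def vartheta_eq_zero_density[OF assms(1)])
qed

theorem theorem2:
  fixes b k :: nat
  assumes "b \<ge> 2" and "k \<ge> 1"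
  shows "alpha b k \<ge> 0 \<and> eta b k \<le> \<lfloor>log (real b) (real k) + 2\<rfloor>"
proof
  show nonneg: "alpha b k \<ge> 0" by (rule alpha_nonneg[OF assms(1)])
  have b: "real b > 1" and k: "real k \<ge> 1" using assms by simp_all
  show "eta b k \<le> \<lfloor>log (real b) (real k) + 2\<rfloor>"
  proof (cases "alpha b k = 0")
    case True
    \<comment> \<open>As 0 has no digits, only the sign of the right side matters here.\<close>
    have "log (real b) (real k) \<ge> 0" using b k by simp
    hence "0 \<le> \<lfloor>log (real b) (real k) + 2\<rfloor>" by linarith
    with True show ?thesis by (simp add: eta_def num_digits_def)
  next
    case False
    have "real_of_int (alpha b k) \<le> real b * real k"
      using alpha_le[OF assms] by (metis of_int_le_iff of_int_of_nat_eq of_nat_mult)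
    hence "log (real b) (real_of_int (alpha b k)) \<le> log (real b) (real b * real k)"
      using False nonneg b k by (subst log_le_cancel_iff) auto
    \<comment> \<open>The factor \<open>b\<close> in the bound for \<open>alpha\<close> adds 1 to
      the logarithm, and counting digits adds another 1.\<close>
    also have "\<dots> = log (real b) (real k) + 1"
      using b k by (subst log_mult) auto
    finally have "\<lfloor>log (real b) (real_of_int (alpha b k)) + 1\<rfloor> \<le> \<lfloor>log (real b) (real k) + 2\<rfloor>"
      by (intro floor_mono) simp
    with False show ?thesis by (simp add: eta_def num_digits_def)
  qed
qed

end
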